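(* Let $u<x<v$ be real numbers and let $f\colon[u,v]_{\mathbb{Q}}\to\mathbb{R}$ be a function whose derivative $f'$ is defined at every point of $[u,v]_{\mathbb{Q}}$, is uniform on $[u,v]_{\mathbb{Q}}$ and is uniformly continuous on $[u,v]_{\mathbb{Q}}$, and suppose that the extended value $f'(x)\neq 0$. Then there exist $b',b''\in[u,v]_{\mathbb{Q}}$ with $f(b')<f(x)<f(b'')$ (where $f(x)$ is the extended value), so $f(x)$ is not a global extreme of $f$.
   Context: For reals $u\le v$, $[u,v]_{\mathbb{Q}}=\{a\in\mathbb{Q}\mid u\le a\le v\}$. For $M\subset\mathbb{Q}$, a function $g\colon M\to\mathbb{R}$ is uniformly continuous (UC) if for every $k\in\mathbb{N}$ there is $l\in\mathbb{N}$ with $a,b\in M$, $|a-b|\le 1/l\Rightarrow |g(a)-g(b)|\le 1/k$. If $g$ is UC and the real $x$ is a limit of a sequence of elements of $M$, then for every sequence $(a_n)$ in $M$ with $a_n\to x$ the sequence $g(a_n)$ converges to a limit independent of $(a_n)$; this limit is denoted $g(x)$ (the extended value). A rational $a\in M$ is a limit point of $M$ if there are $b\in M$ with $0<|a-b|$ arbitrarily small. For $f\colon M\to\mathbb{R}$ and $a\in M$ a limit point of $M$, the derivative $f'(a)=y\in\mathbb{R}$ exists if for every $k$ there is $l$ with $b\in M$, $0<|a-b|\le 1/l\Rightarrow |\frac{f(b)-f(a)}{b-a}-y|\le 1/k$. $D(f)$ is the set of such $a$ where $f'(a)$ exists. The derivative is uniform on $D(f)$ if for every $k$ there is $l$ such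 that for all $a\in D(f)$ and $b\in M$ with $0<|a-b|\le 1/l$ one has $|\frac{f(b)-f(a)}{b-a}-f'(a)|\le 1/k$. *)

theory Defs
  imports "HOL-Analysis.Analysis"
begin

text \<open>
  A function \<open>f : M \<rightarrow> \<real>\<close> with \<open>M \<subseteq> \<rat>\<close> is a total function on the reals of which only the values on
  \<open>M\<close> are ever used. In particular \<open>f x\<close> is meaningless for \<open>x \<notin> M\<close>; the value obtained by continuity
  is \<open>ext_value M f x\<close>.
\<close>

definition rat_interval :: "real \<Rightarrow> real \<Rightarrow> real set" where
  "rat_interval u v = {a \<in> \<rat>. u \<le> a \<and> a \<le> v}"

definition ext_value :: "real set \<Rightarrow> (real \<Rightarrow> real) \<Rightarrow> real \<Rightarrow> real" where
  "ext_value M g x =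
     (THE y. \<forall>a. (\<forall>n. a n \<in> M) \<and> a \<longlonglongrightarrow> x \<longrightarrow> (\<lambda>n. g (a n)) \<longlonglongrightarrow> y)"

definition deriv_dom :: "real set \<Rightarrow> (real \<Rightarrow> real) \<Rightarrow> real set" where
  "deriv_dom M f =
     {a \<in> M. a islimpt M \<and> (\<exists>y. (f has_real_derivative y) (at a within M))}"

definition deriv_within :: "real set \<Rightarrow> (real \<Rightarrow> real) \<Rightarrow> real \<Rightarrow> real" where
  "deriv_within M f a = (THE y. (f has_real_derivative y) (at a within M))"

definition uniform_deriv :: "real set \<Rightarrow> (real \<Rightarrow> real) \<Rightarrow> bool" where
  "uniform_deriv M f \<longleftrightarrow>
     (\<forall>k::nat. k \<ge> 1 \<longrightarrow> (\<exists>l::nat. l \<ge> 1 \<and>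
        (\<forall>a \<in> deriv_dom M f. \<forall>b \<in> M. 0 < \<bar>a - b\<bar> \<and> \<bar>a - b\<bar> \<le> 1 / real l \<longrightarrow>
           \<bar>(f b - f a) / (b - a) - deriv_within M f a\<bar> \<le> 1 / real k)))"

definition global_extreme :: "real set \<Rightarrow> (real \<Rightarrow> real) \<Rightarrow> real \<Rightarrow> bool" where
  "global_extreme M f y \<longleftrightarrow> (\<forall>b \<in> M. f b \<le> y) \<or> (\<forall>b \<in> M. y \<le> f b)"

lemma ext_value_tendsto:
  assumes uc: "uniformly_continuous_on M g"
    and a: "\<And>n. a n \<in> M" "a \<longlonglongrightarrow> x"
  shows "(\<lambda>n. g (a n)) \<longlonglongrightarrow> ext_value M g x"
proof -
  have "x \<in> closure M"
    using a by (auto simp: closure_sequential)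
  then obtain y where y: "(g \<longlongrightarrow> y) (at x within M)"
    using uniformly_continuous_on_extension_at_closure[OF uc] by blast
  have lim: "(\<lambda>n. g (b n)) \<longlonglongrightarrow> (if x \<in> M then g x else y)"
    if b: "\<And>n. b n \<in> M" "b \<longlonglongrightarrow> x" for b
  proof (cases "x \<in> M")
    case True
    then show ?thesis
      using uniformly_continuous_imp_continuous[OF uc] b
      by (auto simp: continuous_on_sequentially o_def)
  next
    case False
    have "b n \<noteq> x" for n using b(1)[of n] False by auto
    then have "filterlim b (at x within M) sequentially"
      using b by (simp add: filterlim_at)
    then show ?thesis using y False by (simp add: filterlim_compose)
  qed
  have "ext_value M g x = (if x \<in> M then g x else y)"
    unfolding ext_value_def
  proof (rule the_equality)
    show "\<forall>a. (\<forall>n. a n \<in> M) \<and> a \<longlonglongrightarrow> x \<longrightarrow>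
            (\<lambda>n. g (a n)) \<longlonglongrightarrow> (if x \<in> M then g x else y)"
      using lim by blast
    show "z = (if x \<in> M then g x else y)"
      if "\<forall>a. (\<forall>n. a n \<in> M) \<and> a \<longlonglongrightarrow> x \<longrightarrow> (\<lambda>n. g (a n)) \<longlonglongrightarrow> z" for z
      using that a lim[OF a] LIMSEQ_unique by blast
  qed
  then show ?thesis using lim[OF a] by simp
qed

lemma has_real_derivative_deriv_within:
  assumes "a \<in> deriv_dom M f"
  shows "(f has_real_derivative deriv_within M f a) (at a within M)"
proof -
  obtain y where y: "(f has_real_derivative y) (at a within M)" and l: "a islimpt M"
    using assms by (auto simp: deriv_dom_def)
  have "z = y" if "(f has_real_derivative z) (at a within M)" for z
    using that y l tendsto_unique[of "at a within M"]
    by (auto simp: has_field_derivative_iff trivial_limit_within)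
  then show ?thesis
    unfolding deriv_within_def using y by (metis theI)
qed

end

theory Submission imports Defs begin

text \<open>
  A uniformly continuous derivative on a bounded set is bounded, so uniform differentiability makes
  \<open>f\<close> uniformly continuous and \<open>f\<close> has extended values. Since the derivative is uniform, the estimate
  \<open>(f b - f a) / (b - a) \<approx> f' a\<close> survives the limit \<open>a \<rightarrow> x\<close>. Hence, for rational \<open>b\<close> near \<open>x\<close>, the
  slope from \<open>x\<close> to \<open>b\<close> has the sign of \<open>f' x \<noteq> 0\<close>, and points \<open>b\<close> on the two sides of \<open>x\<close> give values
  on the two sides of \<open>f x\<close>.
\<close>

text \<open>Passes from tolerances \<open>1 / real k\<close> to arbitrary real ones, in the form
  that the limit arguments below consume.\<close>

lemma uniform_derivD:
  assumes "uniform_deriv M f" "deriv_dom M f = M" "e > 0"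
  obtains d where "d > 0"
    "\<And>a b. \<lbrakk>a \<in> M; b \<in> M; a \<noteq> b; \<bar>a - b\<bar> < d\<rbrakk> \<Longrightarrow>
       \<bar>(f b - f a) / (b - a) - deriv_within M f a\<bar> \<le> e"
proof -
  obtain k :: nat where k: "k \<ge> 1" "1 / real k < e"
    using reals_Archimedean[OF \<open>e > 0\<close>] by (metis One_nat_def Suc_le_eq inverse_eq_divide zero_less_Suc)
  obtain l :: nat where "l \<ge> 1" and l: "\<And>a b. \<lbrakk>a \<in> M; b \<in> M; 0 < \<bar>a - b\<bar>; \<bar>a - b\<bar> \<le> 1 / real l\<rbrakk> \<Longrightarrow>
      \<bar>(f b - f a) / (b - a) - deriv_within M f a\<bar> \<le> 1 / real k"
    using assms(1,2) k(1) unfolding uniform_deriv_def by metis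
  show thesis
  proof
    show "1 / real l > 0" using \<open>l \<ge> 1\<close> by simp
    show "\<bar>(f b - f a) / (b - a) - deriv_within M f a\<bar> \<le> e"
      if "a \<in> M" "b \<in> M" "a \<noteq> b" "\<bar>a - b\<bar> < 1 / real l" for a b
      using l[of a b] that k(2) by simp
  qed
qed

lemma uniform_deriv_imp_uniformly_continuous_on:
  assumes "bounded M" "deriv_dom M f = M" "uniform_deriv M f"
    and "uniformly_continuous_on M (deriv_within M f)"
  shows "uniformly_continuous_on M f"
proof -
  obtain B where B: "B > 0" "\<And>a. a \<in> M \<Longrightarrow> \<bar>deriv_within M f a\<bar> \<le> B"
    using bounded_uniformly_continuous_image[OF assms(4,1)] by (auto simp: bounded_pos)
  obtain d where d: "d > 0" and slope: "\<And>a b. \<lbrakk>a \<in> M; b \<in> M; a \<noteq> b; \<bar>a - b\<bar> < d\<rbrakk> \<Longrightarrow>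
       \<bar>(f b - f a) / (b - a) - deriv_within M f a\<bar> \<le> 1"
    using uniform_derivD[OF assms(3,2) zero_less_one] by blast
  \<comment> \<open>The error 1 in the slope and the bound B on the derivative combine to a
    Lipschitz constant B + 1. It is valid only at distances below d, which suffices for uniform
    continuity.\<close>
  have lip: "\<bar>f b - f a\<bar> \<le> (B + 1) * \<bar>b - a\<bar>" if "a \<in> M" "b \<in> M" "\<bar>a - b\<bar> < d" for a b
  proof (cases "a = b")
    case False
    then have "\<bar>(f b - f a) / (b - a)\<bar> \<le> B + 1"
      using slope[of a b] B(2)[of a] that by linarith
    then show ?thesis
      using False by (simp add: abs_divide divide_simps)
  qed simp
  show ?thesis
    unfolding uniformly_continuous_on_def
  proof (intro allI impI)
    fix e :: real
    assume "e > 0"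
    show "\<exists>d>0. \<forall>a\<in>M. \<forall>b\<in>M. dist b a < d \<longrightarrow> dist (f b) (f a) < e"
    proof (intro exI conjI ballI impI)
      show "min d (e / (B + 1)) > 0" using d \<open>e > 0\<close> B(1) by simp
      fix a b
      assume ab: "a \<in> M" "b \<in> M" "dist b a < min d (e / (B + 1))"
      then have "(B + 1) * \<bar>b - a\<bar> < e"
        using B(1) by (simp add: dist_real_def field_simps)
      then show "dist (f b) (f a) < e"
        using lip[of a b] ab by (simp add: dist_real_def abs_minus_commute)
    qed
  qed
qed

text \<open>Keep b fixed and let the base point a tend to x inside M. The d supplied by uniformity
  does not depend on a, so the same d serves every x in the closure, and the non-strict bound by e
  passes to the limit.\<close>

lemma uniform_deriv_slope_ext_value:
  assumes "deriv_dom M f = M" "uniform_deriv M f"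
    and uc: "uniformly_continuous_on M f" "uniformly_continuous_on M (deriv_within M f)"
    and "e > 0"
  obtains d where "d > 0"
    "\<And>x b. \<lbrakk>x \<in> closure M; b \<in> M; b \<noteq> x; \<bar>x - b\<bar> < d\<rbrakk> \<Longrightarrow>
       \<bar>(f b - ext_value M f x) / (b - x) - ext_value M (deriv_within M f) x\<bar> \<le> e"
proof -
  obtain d where d: "d > 0" and slope: "\<And>a b. \<lbrakk>a \<in> M; b \<in> M; a \<noteq> b; \<bar>a - b\<bar> < d\<rbrakk> \<Longrightarrow>
       \<bar>(f b - f a) / (b - a) - deriv_within M f a\<bar> \<le> e"
    using uniform_derivD[OF assms(2,1,5)] by blast
  have "\<bar>(f b - ext_value M f x) / (b - x) - ext_value M (deriv_within M f) x\<bar> \<le> e"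
    if x: "x \<in> closure M" and b: "b \<in> M" "b \<noteq> x" "\<bar>x - b\<bar> < d" for x b
  proof -
    obtain a where a: "\<And>n. a n \<in> M" "a \<longlonglongrightarrow> x"
      using x by (auto simp: closure_sequential)
    \<comment> \<open>The denominators tend to b - x, which is nonzero; both f and its derivative
      converge along a to their extended values by uniform continuity.\<close>
    have lim: "(\<lambda>n. \<bar>(f b - f (a n)) / (b - a n) - deriv_within M f (a n)\<bar>)
        \<longlonglongrightarrow> \<bar>(f b - ext_value M f x) / (b - x) - ext_value M (deriv_within M f) x\<bar>"
      using b(2) by (intro tendsto_intros ext_value_tendsto uc a) auto
    have "(\<lambda>n. \<bar>a n - b\<bar>) \<longlonglongrightarrow> \<bar>x - b\<bar>"
      by (intro tendsto_intros a)
    then have "\<forall>\<^sub>F n in sequentially. \<bar>a n - b\<bar> < d"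
      using b(3) by (rule order_tendstoD)
    \<comment> \<open>Excludes the degenerate quotient: a n may hit b, but only finitely often
      because its limit x differs from b.\<close>
    moreover have "\<forall>\<^sub>F n in sequentially. a n \<noteq> b"
      using a(2) b(2) by (metis tendsto_imp_eventually_ne)
    ultimately have "\<forall>\<^sub>F n in sequentially.
        \<bar>(f b - f (a n)) / (b - a n) - deriv_within M f (a n)\<bar> \<le> e"
      by eventually_elim (use slope a(1) b(1) in blast)
    then show ?thesis
      by (rule tendsto_upperbound[OF lim]) simp
  qed
  then show thesis using that d by blast
qed

lemma bounded_rat_interval: "bounded (rat_interval u v)"
  by (rule bounded_subset[OF bounded_closed_interval[of u v]]) (auto simp: rat_interval_def)

lemma mem_closure_rat_interval:
  assumes "u < x" "x < v"
  shows "x \<in> closure (rat_interval u v)"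
  unfolding closure_approachable
proof (intro allI impI)
  fix e :: real
  assume "e > 0"
  then obtain q where "q \<in> \<rat>" "x < q" "q < min v (x + e)"
    using Rats_dense_in_real[of x "min v (x + e)"] assms by auto
  then show "\<exists>q\<in>rat_interval u v. dist q x < e"
    using assms by (intro bexI[of _ q]) (auto simp: rat_interval_def dist_real_def)
qed

theorem theorem2p44:
  fixes u x v :: real and f :: "real \<Rightarrow> real"
  assumes "u < x" and "x < v"
    and "deriv_dom (rat_interval u v) f = rat_interval u v"
    and "uniform_deriv (rat_interval u v) f"
    and "uniformly_continuous_on (rat_interval u v) (deriv_within (rat_interval u v) f)"
    and "ext_value (rat_interval u v) (deriv_within (rat_interval u v) f) x \<noteq> 0"
  shows "(\<exists>b' \<in> rat_interval u v. \<exists>b'' \<in> rat_interval u v.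
            f b' < ext_value (rat_interval u v) f x \<and> ext_value (rat_interval u v) f x < f b'')
         \<and> \<not> global_extreme (rat_interval u v) f (ext_value (rat_interval u v) f x)"
proof -
  define M where "M = rat_interval u v"
  define L where "L = ext_value M (deriv_within M f) x"
  define F where "F = ext_value M f x"
  note hyps = assms(3-6)[folded M_def, folded L_def]
  have x: "x \<in> closure M"
    using mem_closure_rat_interval assms(1,2) by (simp add: M_def)
  have uc: "uniformly_continuous_on M f"
    using uniform_deriv_imp_uniformly_continuous_on hyps(1-3) bounded_rat_interval
    by (simp add: M_def)
  \<comment> \<open>Any number within |L|/2 of a nonzero L has the same sign as L, so this tolerance
    fixes the sign of the slopes from x.\<close>
  have "\<bar>L\<bar> / 2 > 0" using hyps(4) by simp
  then obtain d where d: "d > 0" and slope: "\<And>b. \<lbrakk>b \<in> M; b \<noteq> x; \<bar>x - b\<bar> < d\<rbrakk> \<Longrightarrow>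
       \<bar>(f b - F) / (b - x) - L\<bar> \<le> \<bar>L\<bar> / 2"
    using uniform_deriv_slope_ext_value[OF hyps(1,2) uc hyps(3)] x unfolding L_def F_def by metis
  obtain p where p: "p \<in> \<rat>" "max u (x - d) < p" "p < x"
    using Rats_dense_in_real[of "max u (x - d)" x] assms(1) d by auto
  obtain q where q: "q \<in> \<rat>" "x < q" "q < min v (x + d)"
    using Rats_dense_in_real[of x "min v (x + d)"] assms(2) d by auto
  have M: "p \<in> M" "q \<in> M"
    using p q assms(1,2) by (auto simp: M_def rat_interval_def)
  have sp: "\<bar>(f p - F) / (p - x) - L\<bar> \<le> \<bar>L\<bar> / 2"
    using slope[of p] p M by auto
  have sq: "\<bar>(f q - F) / (q - x) - L\<bar> \<le> \<bar>L\<bar> / 2"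
    using slope[of q] q M by auto
  have "\<exists>b'\<in>M. \<exists>b''\<in>M. f b' < F \<and> F < f b''"
  proof (cases "L > 0")
    case True
    then have "(f p - F) / (p - x) > 0" "(f q - F) / (q - x) > 0"
      using sp sq by linarith+
    then have "f p < F" "F < f q"
      using p q by (auto simp: zero_less_divide_iff)
    then show ?thesis using M by blast
  next
    \<comment> \<open>Here L < 0 since L is nonzero, so p and q exchange their roles.\<close>
    case False
    then have "(f p - F) / (p - x) < 0" "(f q - F) / (q - x) < 0"
      using sp sq hyps(4) by linarith+
    then have "f q < F" "F < f p"
      using p q by (auto simp: divide_less_0_iff)
    then show ?thesis using M by blast
  qed
  then show ?thesis
    unfolding global_extreme_def M_def[symmetric] F_def[symmetric] by (meson not_le)
qed

end
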